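(* Let $D\subseteq\mathbb{R}^d$ be open, let $f:D\to\mathbb{R}^d$ be locally Lipschitz, let $x^*\in D$ be an equilibrium of $\dot x=f(x)$, and let $S\subseteq D$ be a compact set with $x^*\in\mathrm{int}(S)$. If, for some $\tau>0$, $V:D\to\mathbb{R}_{\ge 0}$ is a Strict Recurrent Lyapunov Function (SRLF) over $S$, then the equilibrium $x^*$ is asymptotically stable on the set $S$.
   Context: $\|\cdot\|$ is an arbitrary fixed norm on $\mathbb{R}^d$. Locally Lipschitz means: for every compact $K\subset D$ there is $\overline L_K\ge 0$ with $\|f(y)-f(x)\|\le \overline L_K\|y-x\|$ for all $x,y\in K$. For $x\in D$, $\phi(t,x)$ is the solution of $\dot x=f(x)$ with $\phi(0,x)=x$, defined on its maximal open interval of existence $I(x)\ni 0$. An assertion about $\phi(t,x)$ for all $t\ge0$ (or as $t\to\infty$) includes that the solution exists for all $t\ge 0$. Containment times: $T_S(x;\tau):=\{t\in(0,\tau]: \phi(t,x)\in S\}$ (with $t\in I(x)$). An inequality $\min_{s\in T_S(x;\tau)}g(s)\le c$ (resp. $<c$) means that there is $s\in T_S(x;\tau)$ with $g(s)\le c$ (resp. $<c$); in particular $T_S(x;\tau)\neq\emptyset$. SRLF: a continuous function $V:D\to\mathbb{R}_{\ge0}$ is a Strict Recurrent Lyapunov Function over $S$ (for given $\tau>0$) if (i) $V(x^* )=0$ and $V(x)>0$ for all $x\in D\setminus\{x^*\}$; (ii) $\min_{s\in T_S(x;\tau)}V(\phi(s,x))\le V(x)$ for all $x\in S$; and the inequality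 in (ii) is strict for all $x\in S\setminus\{x^*\}$. Asymptotically stable on $S$ (with $x^*\in\mathrm{int}(S)$): (a) stable, i.e. for every $\varepsilon>0$ there is $\delta>0$ such that $\|x-x^*\|\le\delta$ implies $\|\phi(t,x)-x^*\|\le\varepsilon$ for all $t\ge0$; and (b) attractive on $S$, i.e. for every $x\in S$, $\|\phi(t,x)-x^*\|\to0$ as $t\to\infty$. *)

theory Defs
  imports "HOL-Analysis.Analysis"
begin

definition is_norm :: "(real ^ 'd \<Rightarrow> real) \<Rightarrow> bool" where
  "is_norm N \<longleftrightarrow>
     (\<forall>x. 0 \<le> N x) \<and>
     (\<forall>x. N x = 0 \<longleftrightarrow> x = 0) \<and>
     (\<forall>c x. N (c *\<^sub>R x) = \<bar>c\<bar> * N x) \<and>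
     (\<forall>x y. N (x + y) \<le> N x + N y)"

definition locally_lipschitz_on ::
  "(real ^ 'd \<Rightarrow> real) \<Rightarrow> (real ^ 'd) set \<Rightarrow> (real ^ 'd \<Rightarrow> real ^ 'd) \<Rightarrow> bool" where
  "locally_lipschitz_on N D f \<longleftrightarrow>
     (\<forall>K. compact K \<and> K \<subseteq> D \<longrightarrow>
        (\<exists>L\<ge>0. \<forall>x\<in>K. \<forall>y\<in>K. N (f y - f x) \<le> L * N (y - x)))"

definition ivp_solution ::
  "(real ^ 'd) set \<Rightarrow> (real ^ 'd \<Rightarrow> real ^ 'd) \<Rightarrow> real ^ 'd \<Rightarrow> real set \<Rightarrow>
   (real \<Rightarrow> real ^ 'd) \<Rightarrow> bool" where
  "ivp_solution D f x J u \<longleftrightarrow>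
     open J \<and> is_interval J \<and> 0 \<in> J \<and> u 0 = x \<and>
     (\<forall>t\<in>J. u t \<in> D \<and> (u has_vector_derivative f (u t)) (at t))"

definition max_interval ::
  "(real ^ 'd) set \<Rightarrow> (real ^ 'd \<Rightarrow> real ^ 'd) \<Rightarrow> real ^ 'd \<Rightarrow> real set" where
  "max_interval D f x = \<Union>{J. \<exists>u. ivp_solution D f x J u}"

text \<open>The value at time \<open>t\<close> of the maximal solution starting in \<open>x\<close>; it is meaningful for
  \<open>t \<in> max_interval D f x\<close> when \<open>f\<close> is locally Lipschitz, since then all solutions through \<open>x\<close>
  agree on the intersection of their intervals. No claim about it is made below without also
  requiring \<open>t \<in> max_interval D f x\<close>, which is empty for \<open>x \<notin> D\<close>.\<close>

definition flow ::
  "(real ^ 'd) set \<Rightarrow> (real ^ 'd \<Rightarrow> real ^ 'd) \<Rightarrow> real \<Rightarrow> real ^ 'd \<Rightarrow> real ^ 'd" where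
  "flow D f t x = (THE y. \<exists>J u. ivp_solution D f x J u \<and> t \<in> J \<and> u t = y)"

definition equilibrium ::
  "(real ^ 'd) set \<Rightarrow> (real ^ 'd \<Rightarrow> real ^ 'd) \<Rightarrow> real ^ 'd \<Rightarrow> bool" where
  "equilibrium D f xs \<longleftrightarrow> xs \<in> D \<and> f xs = 0"

definition containment_times ::
  "(real ^ 'd) set \<Rightarrow> (real ^ 'd \<Rightarrow> real ^ 'd) \<Rightarrow> (real ^ 'd) set \<Rightarrow> real ^ 'd \<Rightarrow> real \<Rightarrow>
   real set" where
  "containment_times D f S x \<tau> =
     {t \<in> {0<..\<tau>}. t \<in> max_interval D f x \<and> flow D f t x \<in> S}"

definition SRLF ::
  "(real ^ 'd) set \<Rightarrow> (real ^ 'd \<Rightarrow> real ^ 'd) \<Rightarrow> real ^ 'd \<Rightarrow> (real ^ 'd) set \<Rightarrow> real \<Rightarrow>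
   (real ^ 'd \<Rightarrow> real) \<Rightarrow> bool" where
  "SRLF D f xs S \<tau> V \<longleftrightarrow>
     continuous_on D V \<and> (\<forall>x\<in>D. 0 \<le> V x) \<and>
     V xs = 0 \<and> (\<forall>x\<in>D - {xs}. 0 < V x) \<and>
     (\<forall>x\<in>S. \<exists>s\<in>containment_times D f S x \<tau>. V (flow D f s x) \<le> V x) \<and>
     (\<forall>x\<in>S - {xs}. \<exists>s\<in>containment_times D f S x \<tau>. V (flow D f s x) < V x)"

definition stable ::
  "(real ^ 'd \<Rightarrow> real) \<Rightarrow> (real ^ 'd) set \<Rightarrow> (real ^ 'd \<Rightarrow> real ^ 'd) \<Rightarrow> real ^ 'd \<Rightarrow> bool" where
  "stable N D f xs \<longleftrightarrow>
     (\<forall>\<epsilon>>0. \<exists>\<delta>>0. \<forall>x. N (x - xs) \<le> \<delta> \<longrightarrow>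
        (\<forall>t\<ge>0. t \<in> max_interval D f x \<and> N (flow D f t x - xs) \<le> \<epsilon>))"

definition attractive_on ::
  "(real ^ 'd \<Rightarrow> real) \<Rightarrow> (real ^ 'd) set \<Rightarrow> (real ^ 'd \<Rightarrow> real ^ 'd) \<Rightarrow> real ^ 'd \<Rightarrow>
   (real ^ 'd) set \<Rightarrow> bool" where
  "attractive_on N D f xs S \<longleftrightarrow>
     (\<forall>x\<in>S. {0..} \<subseteq> max_interval D f x \<and>
        ((\<lambda>t. N (flow D f t x - xs)) \<longlongrightarrow> 0) at_top)"

definition asymptotically_stable_on ::
  "(real ^ 'd \<Rightarrow> real) \<Rightarrow> (real ^ 'd) set \<Rightarrow> (real ^ 'd \<Rightarrow> real ^ 'd) \<Rightarrow> real ^ 'd \<Rightarrow>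
   (real ^ 'd) set \<Rightarrow> bool" where
  "asymptotically_stable_on N D f xs S \<longleftrightarrow> stable N D f xs \<and> attractive_on N D f xs S"

end

theory Submission
  imports Defs
begin

text \<open>Every point of \<open>S\<close> returns to \<open>S\<close>, without increasing \<open>V\<close>, at some time in \<open>[\<tau>, 2\<tau>]\<close>;
  hence solutions starting in \<open>S\<close> are global. A point close to the equilibrium therefore returns
  again and again to a small sublevel set of \<open>V\<close> in \<open>S\<close>, and between two returns Gronwall's
  inequality keeps it close: this is stability. For attractivity, minimise \<open>V\<close> over the intersection
  of \<open>S\<close> with the \<open>\<omega>\<close>-limit set of a trajectory. This set is nonempty and compact, and the limit
  set is forward invariant, so the strict inequality excludes every minimiser but the equilibrium;
  stability then upgrades recurrence to convergence.\<close>

section \<open>Gronwall's inequality and the Picard-Lindelof theorem\<close>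

lemma vector_derivative_lipschitz_bound:
  fixes g :: "real \<Rightarrow> 'a::real_normed_vector"
  assumes "\<And>t. t \<in> {a..b} \<Longrightarrow> (g has_vector_derivative g' t) (at t within {a..b})"
    and "\<And>t. t \<in> {a..b} \<Longrightarrow> norm (g' t) \<le> B"
    and "s \<in> {a..b}" "t \<in> {a..b}"
  shows "norm (g s - g t) \<le> B * \<bar>s - t\<bar>"
proof -
  have "onorm (\<lambda>h. h *\<^sub>R g' r) \<le> B" if "r \<in> {a..b}" for r
    by (rule onorm_le) (use assms(2)[OF that] in \<open>simp add: mult.commute[of B] mult_left_mono\<close>)
  then have "norm (g s - g t) \<le> B * norm (s - t)"
    using assms by (intro differentiable_bound[of "{a..b}" g "\<lambda>r h. h *\<^sub>R g' r"])
      (auto simp: has_vector_derivative_def)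
  then show ?thesis by simp
qed

text \<open>By Cauchy-Schwarz and the Lipschitz bound, the squared distance times
  \<open>exp (- 2 * L * t)\<close> has nonpositive derivative; the square stays differentiable where
  the distance vanishes. \<open>K\<close> is demanded only at interior times, so the bound still
  holds at the moment when a solution leaves \<open>K\<close>.\<close>

lemma gronwall_dist:
  fixes u v :: "real \<Rightarrow> 'a::real_inner"
  assumes u: "\<And>t. t \<in> {0..s} \<Longrightarrow> (u has_vector_derivative f (u t)) (at t)"
    and v: "\<And>t. t \<in> {0..s} \<Longrightarrow> (v has_vector_derivative f (v t)) (at t)"
    and K: "\<And>t. 0 < t \<Longrightarrow> t < s \<Longrightarrow> u t \<in> K \<and> v t \<in> K"
    and L: "L-lipschitz_on K f"
    and s: "0 \<le> s"
  shows "dist (u s) (v s) \<le> dist (u 0) (v 0) * exp (L * s)"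
proof -
  define w where "w t = u t - v t" for t
  define g where "g t = (w t \<bullet> w t) * exp (- 2 * L * t)" for t
  have w: "(w has_vector_derivative f (u t) - f (v t)) (at t)" if "t \<in> {0..s}" for t
    unfolding w_def using that by (intro has_vector_derivative_diff u v)
  have g: "(g has_real_derivative
      (2 * (w t \<bullet> (f (u t) - f (v t))) - 2 * L * (w t \<bullet> w t)) * exp (- 2 * L * t)) (at t)"
    if t: "t \<in> {0..s}" for t
  proof -
    have "((\<lambda>t. w t \<bullet> w t) has_real_derivative 2 * (w t \<bullet> (f (u t) - f (v t)))) (at t)"
      unfolding has_real_derivative_iff_has_vector_derivative
      using bounded_bilinear.has_vector_derivative[OF bounded_bilinear_inner w[OF t] w[OF t]]
      by (simp add: inner_commute)
    moreover have "((\<lambda>t. exp (- 2 * L * t)) has_real_derivative - 2 * L * exp (- 2 * L * t)) (at t)"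
      by (auto intro!: derivative_eq_intros)
    ultimately show ?thesis
      unfolding g_def by (rule DERIV_mult[THEN DERIV_cong]) (simp add: algebra_simps)
  qed
  have "g s \<le> g 0"
  proof (rule DERIV_nonpos_imp_decreasing_open[OF s])
    fix t assume t: "0 < t" "t < s"
    have "w t \<bullet> (f (u t) - f (v t)) \<le> norm (w t) * norm (f (u t) - f (v t))"
      by (rule norm_cauchy_schwarz)
    also have "\<dots> \<le> norm (w t) * (L * norm (w t))"
      using lipschitz_onD[OF L] K[OF t] by (intro mult_left_mono) (auto simp: w_def dist_norm)
    finally have "w t \<bullet> (f (u t) - f (v t)) \<le> L * (w t \<bullet> w t)"
      by (simp add: dot_square_norm power2_eq_square ac_simps)
    then show "\<exists>y. (g has_real_derivative y) (at t) \<and> y \<le> 0"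
      using g[of t] t by (intro exI conjI) (auto intro!: mult_nonpos_nonneg)
  next
    show "continuous_on {0..s} g"
      using g by (intro continuous_at_imp_continuous_on) (blast intro: DERIV_isCont)
  qed
  then have "(norm (w s))\<^sup>2 * exp (- 2 * L * s) \<le> (norm (w 0))\<^sup>2"
    by (simp add: g_def dot_square_norm)
  then have "(norm (w s))\<^sup>2 * exp (- 2 * L * s) * exp (2 * L * s) \<le> (norm (w 0))\<^sup>2 * exp (2 * L * s)"
    by (rule mult_right_mono) simp
  then have "(norm (w s))\<^sup>2 \<le> (norm (w 0) * exp (L * s))\<^sup>2"
    by (simp add: power_mult_distrib mult.assoc flip: exp_add exp_double)
  then have "norm (w s) \<le> norm (w 0) * exp (L * s)"
    by (rule power2_le_imp_le) simp
  then show ?thesis by (simp add: w_def dist_norm)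
qed

text \<open>Only the tube around \<open>u\<close> is assumed to lie in \<open>K\<close>; that
  \<open>v\<close> stays in the tube is a continuity argument. At a first time with distance at
  least \<open>r\<close>, Gronwall's bound would already give a distance below
  \<open>r\<close>.\<close>

lemma gronwall_tube:
  fixes u v :: "real \<Rightarrow> 'a::real_inner"
  assumes u: "\<And>t. t \<in> {0..s} \<Longrightarrow> (u has_vector_derivative f (u t)) (at t)"
    and v: "\<And>t. t \<in> {0..s} \<Longrightarrow> (v has_vector_derivative f (v t)) (at t)"
    and K: "\<And>t. t \<in> {0..s} \<Longrightarrow> cball (u t) r \<subseteq> K"
    and L: "L-lipschitz_on K f"
    and r: "dist (u 0) (v 0) * exp (L * s) < r"
    and t: "t \<in> {0..s}"
  shows "dist (u t) (v t) \<le> dist (u 0) (v 0) * exp (L * t)"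
proof -
  have L0: "0 \<le> L" using L by (rule lipschitz_on_nonneg)
  have "0 \<le> dist (u 0) (v 0) * exp (L * s)" by simp
  with r have r0: "0 < r" by linarith
  have gron: "dist (u a) (v a) \<le> dist (u 0) (v 0) * exp (L * a)"
    if a: "a \<in> {0..s}" and small: "\<And>b. 0 \<le> b \<Longrightarrow> b < a \<Longrightarrow> dist (u b) (v b) < r" for a
  proof (rule gronwall_dist[OF _ _ _ L])
    fix b assume b: "0 < b" "b < a"
    with a have "cball (u b) r \<subseteq> K" by (intro K) auto
    moreover have "u b \<in> cball (u b) r" "v b \<in> cball (u b) r" using small[of b] b r0 by auto
    ultimately show "u b \<in> K \<and> v b \<in> K" by blast
  qed (use a u v in auto)
  have cu: "continuous_on {0..s} u" "continuous_on {0..s} v"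
    using u v by (meson continuous_at_imp_continuous_on has_vector_derivative_continuous)+
  \<comment> \<open>The exit times form a compact set, so if there is one, there is a first
    one.\<close>
  define E where "E = {a \<in> {0..s}. r \<le> dist (u a) (v a)}"
  have "closed E"
    unfolding E_def by (intro continuous_on_closed_Collect_le continuous_intros cu closed_atLeastAtMost)
  then have "compact E"
    by (auto simp: compact_eq_bounded_closed E_def intro: bounded_subset[OF bounded_closed_interval])
  have "E = {}"
  proof (rule ccontr)
    assume "E \<noteq> {}"
    then obtain a where a: "a \<in> E" "\<And>b. b \<in> E \<Longrightarrow> a \<le> b"
      using compact_attains_inf[OF \<open>compact E\<close>] by blast
    have "dist (u a) (v a) \<le> dist (u 0) (v 0) * exp (L * a)"
    proof (rule gron)
      fix b assume "0 \<le> b" "b < a"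
      with a show "dist (u b) (v b) < r" by (force simp: E_def)
    qed (use a in \<open>auto simp: E_def\<close>)
    also have "\<dots> \<le> dist (u 0) (v 0) * exp (L * s)"
      using a L0 by (intro mult_left_mono) (auto simp: E_def mult_left_mono)
    finally show False using r a by (auto simp: E_def)
  qed
  then have "dist (u b) (v b) < r" if "b \<in> {0..s}" for b using that by (force simp: E_def)
  with t show ?thesis by (intro gron) auto
qed

text \<open>Banach's fixed point theorem for the Picard operator on bounded continuous functions;
  \<open>h * L\<close> is the contraction factor.\<close>

lemma picard_lindelof_global:
  fixes F :: "'a::banach \<Rightarrow> 'a"
  assumes F: "L-lipschitz_on UNIV F" and h: "0 < h" "h * L < 1"
  obtains u where "u 0 = x" "\<And>t. t \<in> {-h..h} \<Longrightarrow> (u has_vector_derivative F (u t)) (at t within {-h..h})"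
proof -
  \<comment> \<open>The function space consists of functions on the whole line. Clamping time to
    \<open>{-h..h}\<close> makes each Picard iterate bounded and continuous there.\<close>
  define c where "c t = max (-h) (min h t)" for t :: real
  have c: "c t \<in> {-h..h}" "t \<in> {-h..h} \<Longrightarrow> c t = t" for t using h by (auto simp: c_def)
  have L0: "0 \<le> L" using F by (rule lipschitz_on_nonneg)
  \<comment> \<open>Integrating from \<open>-h\<close> avoids oriented integrals for negative times;
    subtracting \<open>J w 0\<close> restores the initial value \<open>x\<close>.\<close>
  define J where "J w t = integral {-h..t} (\<lambda>s. F (w s))" for w and t :: real
  define P where "P w t = x + J w t - J w 0" for w t
  have P': "(P (apply_bcontfun w) has_vector_derivative F (w t)) (at t within {-h..h})"
    if "t \<in> {-h..h}" for w :: "real \<Rightarrow>\<^sub>C 'a" and t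
  proof -
    have "continuous_on {-h..h} (\<lambda>s. F (w s))"
      by (intro continuous_on_compose2[OF lipschitz_on_continuous_on[OF F]] continuous_on_apply_bcontfun) auto
    from integral_has_vector_derivative[OF this that] show ?thesis
      unfolding P_def J_def by (auto intro!: derivative_eq_intros)
  qed
  have cont: "continuous_on {-h..h} (P (apply_bcontfun w))" for w :: "real \<Rightarrow>\<^sub>C 'a"
    using P' by (meson continuous_on_eq_continuous_within has_vector_derivative_continuous)
  have bc: "(\<lambda>t. P (apply_bcontfun w) (c t)) \<in> bcontfun" for w :: "real \<Rightarrow>\<^sub>C 'a"
  proof -
    have "continuous_on UNIV (\<lambda>t. P (apply_bcontfun w) (c t))"
      by (rule continuous_on_compose2[OF cont]) (use h in \<open>auto simp: c_def intro!: continuous_intros\<close>)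
    moreover have "bounded (range (\<lambda>t. P (apply_bcontfun w) (c t)))"
      by (rule bounded_subset[OF compact_imp_bounded[OF compact_continuous_image[OF cont]]])
        (use c in auto)
    ultimately show ?thesis by (simp add: bcontfun_def)
  qed
  define Q where "Q w = Bcontfun (\<lambda>t. P (apply_bcontfun w) (c t))" for w :: "real \<Rightarrow>\<^sub>C 'a"
  have Q: "apply_bcontfun (Q w) t = P (apply_bcontfun w) (c t)" for w t
    unfolding Q_def by (simp add: Bcontfun_inverse[OF bc])
  \<comment> \<open>The difference of two iterates vanishes at time 0 and has derivative at most
    \<open>L * dist w z\<close>, so over a time of at most \<open>h\<close> it grows to at most
    \<open>h * L * dist w z\<close>.\<close>
  have "dist (Q w) (Q z) \<le> (h * L) * dist w z" for w z
  proof (rule dist_bound)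
    fix t
    define g where "g t = P (apply_bcontfun w) t - P (apply_bcontfun z) t" for t
    have "norm (g (c t) - g 0) \<le> (L * dist w z) * \<bar>c t - 0\<bar>"
    proof (rule vector_derivative_lipschitz_bound)
      fix t assume "t \<in> {-h..h}"
      then show "(g has_vector_derivative F (w t) - F (z t)) (at t within {-h..h})"
        unfolding g_def by (intro has_vector_derivative_diff P')
      have "norm (F (w t) - F (z t)) \<le> L * dist (w t) (z t)"
        using lipschitz_onD[OF F, of "w t" "z t"] by (simp add: dist_norm)
      also have "\<dots> \<le> L * dist w z" by (intro mult_left_mono dist_bounded L0)
      finally show "norm (F (w t) - F (z t)) \<le> L * dist w z" .
    qed (use c h in auto)
    also have "\<dots> \<le> (L * dist w z) * h"
      using c[of t] L0 by (intro mult_left_mono) auto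
    finally show "dist (Q w t) (Q z t) \<le> (h * L) * dist w z"
      by (simp add: Q dist_norm g_def P_def ac_simps)
  qed
  then obtain w where w: "Q w = w"
    using banach_fix_type[of "h * L" Q] h L0 by auto
  have wt: "w t = P (apply_bcontfun w) t" if "t \<in> {-h..h}" for t
    using Q[of w t] c(2)[OF that] by (simp add: w)
  show thesis
  proof
    show "w 0 = x" using wt[of 0] h by (simp add: P_def)
    show "(apply_bcontfun w has_vector_derivative F (w t)) (at t within {-h..h})"
      if "t \<in> {-h..h}" for t
      using P'[OF that] by (rule has_vector_derivative_transform[rotated -1]) (use that wt in auto)
  qed
qed

text \<open>Composing with the projection onto the ball makes the field globally Lipschitz; the solution
  stays in the ball, where nothing has changed.\<close>

lemma picard_lindelof:
  fixes f :: "'a::euclidean_space \<Rightarrow> 'a"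
  assumes f: "L-lipschitz_on (cball x r) f" and M: "\<And>y. y \<in> cball x r \<Longrightarrow> norm (f y) \<le> M"
    and r: "0 \<le> r" and h: "0 < h" "h * L < 1" "h * M \<le> r"
  obtains u where "u 0 = x"
    "\<And>t. t \<in> {-h<..<h} \<Longrightarrow> u t \<in> cball x r \<and> (u has_vector_derivative f (u t)) (at t)"
proof -
  have ne: "cball x r \<noteq> {}" using r by simp
  define F where "F y = f (closest_point (cball x r) y)" for y
  have cp: "closest_point (cball x r) y \<in> cball x r" for y
    using ne by (intro closest_point_in_set) auto
  have "L-lipschitz_on UNIV F"
  proof (rule lipschitz_onI)
    fix y z :: 'a
    have "dist (F y) (F z) \<le> L * dist (closest_point (cball x r) y) (closest_point (cball x r) z)"
      unfolding F_def by (intro lipschitz_onD[OF f] cp)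
    also have "\<dots> \<le> L * dist y z"
      using ne by (intro mult_left_mono closest_point_lipschitz lipschitz_on_nonneg[OF f]) auto
    finally show "dist (F y) (F z) \<le> L * dist y z" .
  qed (rule lipschitz_on_nonneg[OF f])
  then obtain u where u: "u 0 = x"
    "\<And>t. t \<in> {-h..h} \<Longrightarrow> (u has_vector_derivative F (u t)) (at t within {-h..h})"
    using picard_lindelof_global h by blast
  have M0: "0 \<le> M" using M[of x] r norm_ge_zero[of "f x"] by (simp del: norm_ge_zero)
  \<comment> \<open>Every value of \<open>F\<close> is a value of \<open>f\<close> on the ball, so
    the speed is at most \<open>M\<close> and the path travels at most
    \<open>h * M \<le> r\<close>.\<close>
  have ball: "u t \<in> cball x r" if t: "t \<in> {-h..h}" for t
  proof -
    have "norm (u t - u 0) \<le> M * \<bar>t - 0\<bar>"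
      by (rule vector_derivative_lipschitz_bound[OF u(2)]) (use t h M cp in \<open>auto simp: F_def\<close>)
    also have "\<dots> \<le> M * h" using t M0 by (intro mult_left_mono) auto
    finally show ?thesis using h u(1) by (simp add: dist_norm norm_minus_commute mult.commute)
  qed
  show thesis
  proof (rule that[of u])
    show "u 0 = x" by (rule u(1))
    fix t assume t: "t \<in> {-h<..<h}"
    have "(u has_vector_derivative F (u t)) (at t)"
      using u(2)[of t] t at_within_interior[of t "{-h..h}"] by (simp add: interior_atLeastAtMost_real)
    moreover have "F (u t) = f (u t)"
      using ball[of t] t by (simp add: F_def closest_point_self)
    ultimately show "u t \<in> cball x r \<and> (u has_vector_derivative f (u t)) (at t)"
      using ball[of t] t by auto
  qed
qed

section \<open>The maximal flow of a locally Lipschitz field\<close>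

text \<open>Time reversal turns uniqueness at negative times into forward uniqueness for the field
  \<open>- f\<close>.\<close>

lemma ivp_solution_reverse:
  assumes "ivp_solution D f x J u"
  shows "ivp_solution D (\<lambda>y. - f y) x (uminus ` J) (\<lambda>t. u (- t))"
proof -
  have "((\<lambda>t. u (- t)) has_vector_derivative - f (u (- t))) (at t)" if "- t \<in> J" for t
  proof -
    have "(u has_vector_derivative f (u (- t))) (at (- t))"
      using assms that by (simp add: ivp_solution_def)
    moreover have "((\<lambda>t. - t) has_vector_derivative - 1) (at t)"
      by (auto intro!: derivative_eq_intros)
    ultimately show ?thesis
      using vector_diff_chain_at[of "\<lambda>t. - t" "-1" t u] by (simp add: o_def)
  qed
  moreover have "is_interval (uminus ` J)" "open (uminus ` J)"
    using assms by (auto simp: ivp_solution_def intro: open_negations)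
  moreover have "- t \<in> J" if "t \<in> uminus ` J" for t using that by auto
  ultimately show ?thesis
    using assms unfolding ivp_solution_def by (intro conjI ballI) auto
qed

lemma ivp_solution_shift:
  assumes "ivp_solution D f x J u" and "t \<in> J"
  shows "ivp_solution D f (u t) ((\<lambda>s. s - t) ` J) (\<lambda>s. u (t + s))"
proof -
  have "((\<lambda>s. u (t + s)) has_vector_derivative f (u (t + s))) (at s)" if "t + s \<in> J" for s
  proof -
    have "(u has_vector_derivative f (u (t + s))) (at (t + s))"
      using assms that by (simp add: ivp_solution_def)
    moreover have "((\<lambda>s. t + s) has_vector_derivative 1) (at s)"
      by (auto intro!: derivative_eq_intros)
    ultimately show ?thesis
      using vector_diff_chain_at[of "\<lambda>s. t + s" 1 s u] by (simp add: o_def)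
  qed
  moreover have "is_interval ((\<lambda>s. s - t) ` J)" "open ((\<lambda>s. s - t) ` J)"
    using assms open_translation[of J "- t"] is_interval_translation[of "-t" J]
    by (auto simp: ivp_solution_def)
  moreover have "t + s \<in> J" if "s \<in> (\<lambda>s. s - t) ` J" for s using that by auto
  ultimately show ?thesis
    using assms unfolding ivp_solution_def by (intro conjI ballI) auto
qed

lemma ivp_solution_interval_subset:
  assumes "ivp_solution D f x J u" and "s \<in> J" and "0 \<le> s"
  shows "{0..s} \<subseteq> J"
  using assms by (auto simp: ivp_solution_def is_interval_1)

text \<open>The Lipschitz condition is Euclidean, as the inner product argument for Gronwall
  requires; the given norm is converted in the final theorem. The locale is also interpreted for
  \<open>- f\<close>.\<close>

locale lipschitz_field =
  fixes D :: "(real ^ 'd) set" and f :: "real ^ 'd \<Rightarrow> real ^ 'd"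
  assumes open_D: "open D"
    and lipschitz_compact: "\<And>K. compact K \<Longrightarrow> K \<subseteq> D \<Longrightarrow> \<exists>L. L-lipschitz_on K f"
begin

abbreviation I :: "real ^ 'd \<Rightarrow> real set" where "I \<equiv> max_interval D f"
abbreviation \<phi> :: "real \<Rightarrow> real ^ 'd \<Rightarrow> real ^ 'd" where "\<phi> \<equiv> flow D f"

lemma lipschitz_field_reverse: "lipschitz_field D (\<lambda>y. - f y)"
proof
  show "open D" by (rule open_D)
  show "\<exists>L. L-lipschitz_on K (\<lambda>y. - f y)" if "compact K" "K \<subseteq> D" for K
    using lipschitz_compact[OF that] by (auto simp: lipschitz_on_def dist_minus)
qed

text \<open>A compact subset of an open set has a closed neighbourhood of uniform width inside it,
  and this neighbourhood is again compact. It provides one Lipschitz constant for all solutions near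
  \<open>K\<close>.\<close>

lemma lipschitz_tube:
  assumes "compact K" "K \<subseteq> D"
  obtains r L where "0 < r" "compact (\<Union>x\<in>K. cball x r)" "(\<Union>x\<in>K. cball x r) \<subseteq> D"
    "L-lipschitz_on (\<Union>x\<in>K. cball x r) f"
proof -
  obtain r where r: "0 < r" "(\<Union>x\<in>K. cball x r) \<subseteq> D"
    using compact_subset_open_imp_cball_epsilon_subset[OF assms(1) open_D assms(2)] .
  have c: "compact (\<Union>x\<in>K. cball x r)" using assms(1) by (rule compact_minkowski_sum_cball)
  then show thesis using lipschitz_compact[OF c r(2)] r that by blast
qed

lemma continuous_dependence:
  assumes u: "ivp_solution D f x J u" and s: "s \<in> J" "0 \<le> s"
  obtains C d where "0 < C" "0 < d"
    "\<And>y J' v t. ivp_solution D f y J' v \<Longrightarrow> s \<in> J' \<Longrightarrow> dist x y < d \<Longrightarrow> t \<in> {0..s} \<Longrightarrow>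
       dist (u t) (v t) \<le> C * dist x y"
proof -
  have sub: "{0..s} \<subseteq> J" using ivp_solution_interval_subset u s .
  have u': "(u has_vector_derivative f (u t)) (at t)" "u t \<in> D" if "t \<in> {0..s}" for t
    using u sub that by (auto simp: ivp_solution_def)
  have "compact (u ` {0..s})"
    using u' by (intro compact_continuous_image)
      (meson continuous_at_imp_continuous_on has_vector_derivative_continuous, simp)
  moreover have "u ` {0..s} \<subseteq> D" using u' by auto
  ultimately obtain r L where r: "0 < r" and L: "L-lipschitz_on (\<Union>x\<in>u ` {0..s}. cball x r) f"
    using lipschitz_tube by metis
  show thesis
  \<comment> \<open>Gronwall's factor on \<open>{0..s}\<close> is at most
    \<open>exp (L * s)\<close>; starting closer than \<open>r / exp (L * s)\<close> keeps the second
    solution in the tube of radius \<open>r\<close>.\<close>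
  proof (rule that[of "exp (L * s)" "r / exp (L * s)"])
    fix y J' v t
    assume v: "ivp_solution D f y J' v" and s': "s \<in> J'" and d: "dist x y < r / exp (L * s)"
      and t: "t \<in> {0..s}"
    have sub': "{0..s} \<subseteq> J'" using ivp_solution_interval_subset v s' s(2) .
    have 0: "u 0 = x" "v 0 = y" using u v by (auto simp: ivp_solution_def)
    have "dist (u t) (v t) \<le> dist (u 0) (v 0) * exp (L * t)"
    proof (rule gronwall_tube[OF _ _ _ L _ t])
      show "dist (u 0) (v 0) * exp (L * s) < r" using d by (simp add: 0 field_simps)
    qed (use u' v sub' in \<open>auto simp: ivp_solution_def\<close>)
    also have "\<dots> \<le> dist (u 0) (v 0) * exp (L * s)"
      using t lipschitz_on_nonneg[OF L] by (intro mult_left_mono) (auto intro: mult_left_mono)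
    finally show "dist (u t) (v t) \<le> exp (L * s) * dist x y" by (simp add: 0 mult.commute)
  qed (use r in auto)
qed

lemma unique_solution_forward:
  assumes u: "ivp_solution D f x J u" and v: "ivp_solution D f x J' v"
    and t: "t \<in> J" "t \<in> J'" "0 \<le> t"
  shows "u t = v t"
proof -
  obtain C d where "0 < d" and *: "\<And>y J' v s. ivp_solution D f y J' v \<Longrightarrow> t \<in> J' \<Longrightarrow>
      dist x y < d \<Longrightarrow> s \<in> {0..t} \<Longrightarrow> dist (u s) (v s) \<le> C * dist x y"
    using continuous_dependence[OF u t(1,3)] by metis
  then have "dist (u t) (v t) \<le> 0" using *[OF v t(2), of t] t by simp
  then show ?thesis by simp
qed

lemma unique_solution:
  assumes u: "ivp_solution D f x J u" and v: "ivp_solution D f x J' v"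
    and t: "t \<in> J" "t \<in> J'"
  shows "u t = v t"
proof (cases "0 \<le> t")
  case True
  then show ?thesis using unique_solution_forward assms by blast
next
  case False
  interpret rev: lipschitz_field D "\<lambda>y. - f y" by (rule lipschitz_field_reverse)
  show ?thesis
    using rev.unique_solution_forward[OF u[THEN ivp_solution_reverse] v[THEN ivp_solution_reverse], of "- t"]
      t False by simp
qed

text \<open>Uniqueness makes the definite description in \<open>flow\<close> well defined, so any
  solution computes the flow.\<close>

lemma flow_eq:
  assumes "ivp_solution D f x J u" "t \<in> J"
  shows "t \<in> I x" "\<phi> t x = u t"
proof -
  show "t \<in> I x" using assms by (auto simp: max_interval_def)
  show "\<phi> t x = u t"
    unfolding flow_def using assms unique_solution by (intro the_equality) blast+
qed

lemma flow_ivp_solution: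
  assumes "t \<in> I x"
  shows "ivp_solution D f x (I x) (\<lambda>t. \<phi> t x)"
proof -
  obtain J0 u0 where J0: "ivp_solution D f x J0 u0" using assms by (auto simp: max_interval_def)
  have "open (I x)" by (auto simp: max_interval_def ivp_solution_def)
  \<comment> \<open>All the intervals in the union contain 0, so the union is connected.\<close>
  moreover have "is_interval (I x)"
    unfolding max_interval_def is_interval_connected_1
    by (rule connected_Union) (auto simp: ivp_solution_def is_interval_connected_1)
  moreover have "0 \<in> I x" "\<phi> 0 x = x"
    using flow_eq[OF J0, of 0] J0 by (auto simp: ivp_solution_def)
  moreover have "\<phi> t x \<in> D \<and> ((\<lambda>t. \<phi> t x) has_vector_derivative f (\<phi> t x)) (at t)" if t: "t \<in> I x" for t
  proof -
    obtain J u where J: "ivp_solution D f x J u" "t \<in> J" using t by (auto simp: max_interval_def)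
    have "((\<lambda>t. \<phi> t x) has_vector_derivative f (u t)) (at t)"
    proof (rule has_vector_derivative_transform_within_open)
      show "(u has_vector_derivative f (u t)) (at t)" "open J"
        using J by (auto simp: ivp_solution_def)
    qed (use J flow_eq in auto)
    moreover have "u t \<in> D" using J by (auto simp: ivp_solution_def)
    ultimately show ?thesis by (simp add: flow_eq(2)[OF J])
  qed
  ultimately show ?thesis by (simp add: ivp_solution_def)
qed

lemma flow_zero: "t \<in> I x \<Longrightarrow> \<phi> 0 x = x"
  and max_interval_zero: "t \<in> I x \<Longrightarrow> 0 \<in> I x"
  and flow_in_domain: "t \<in> I x \<Longrightarrow> \<phi> t x \<in> D"
  using flow_ivp_solution by (auto simp: ivp_solution_def)

lemma max_interval_between: "s \<in> I x \<Longrightarrow> {0..s} \<subseteq> I x"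
  using flow_ivp_solution[of s x] by (auto simp: ivp_solution_def is_interval_1)

lemma continuous_on_flow:
  assumes "T \<subseteq> I x"
  shows "continuous_on T (\<lambda>t. \<phi> t x)"
proof (rule continuous_at_imp_continuous_on, rule ballI)
  fix t assume "t \<in> T"
  with assms have "t \<in> I x" by blast
  with flow_ivp_solution[OF this] show "isCont (\<lambda>t. \<phi> t x) t"
    by (auto simp: ivp_solution_def intro: has_vector_derivative_continuous)
qed

lemma flow_shift:
  assumes "t \<in> I x" "t + s \<in> I x"
  shows "s \<in> I (\<phi> t x)" "\<phi> s (\<phi> t x) = \<phi> (t + s) x"
proof -
  have sol: "ivp_solution D f (\<phi> t x) ((\<lambda>s. s - t) ` I x) (\<lambda>s. \<phi> (t + s) x)"
    using ivp_solution_shift[OF flow_ivp_solution[OF assms(1)] assms(1)] .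
  have s: "s \<in> (\<lambda>s. s - t) ` I x" using assms(2) by (force intro: image_eqI[of _ _ "t + s"])
  show "s \<in> I (\<phi> t x)" "\<phi> s (\<phi> t x) = \<phi> (t + s) x" using flow_eq[OF sol s] by auto
qed

text \<open>The solution from \<open>x\<close> and the shifted solution from
  \<open>\<phi> t x\<close> agree where both exist. Gluing them gives a solution from
  \<open>x\<close> on the union of the two intervals, which the maximal interval must
  contain.\<close>

lemma flow_extend:
  assumes t: "t \<in> I x" and s: "s \<in> I (\<phi> t x)"
  shows "t + s \<in> I x"
proof -
  let ?y = "\<phi> t x"
  define J where "J = I x \<union> (\<lambda>s. t + s) ` I ?y"
  define w where "w r = (if r \<in> I x then \<phi> r x else \<phi> (r - t) ?y)" for r
  have x: "ivp_solution D f x (I x) (\<lambda>t. \<phi> t x)" and y: "ivp_solution D f ?y (I ?y) (\<lambda>t. \<phi> t ?y)"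
    using flow_ivp_solution t s by auto
  \<comment> \<open>\<open>w\<close> is the second piece on all of its open interval, overlap
    included; this lets the derivative transfer at points outside \<open>I x\<close>.\<close>
  have w2: "w r = \<phi> (r - t) ?y" if "r - t \<in> I ?y" for r
    using flow_shift[OF t, of "r - t"] by (auto simp: w_def)
  have mem: "r \<in> (\<lambda>s. t + s) ` I ?y \<longleftrightarrow> r - t \<in> I ?y" for r
    by (force intro: image_eqI[of _ _ "r - t"])
  have o: "open (I x)" "open ((\<lambda>s. t + s) ` I ?y)"
    using x y by (auto simp: ivp_solution_def intro: open_translation)
  have "ivp_solution D f x J w"
    unfolding ivp_solution_def
  proof (intro conjI ballI)
    show "open J" unfolding J_def using o by blast
    have "connected (I x)" "connected ((\<lambda>s. t + s) ` I ?y)"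
      using x y by (auto simp: ivp_solution_def simp flip: is_interval_connected_1)
    moreover have "t \<in> I x \<inter> (\<lambda>s. t + s) ` I ?y"
      using t y by (auto simp: mem ivp_solution_def)
    ultimately show "is_interval J"
      unfolding J_def is_interval_connected_1 by (intro connected_Un) auto
    show "0 \<in> J" "w 0 = x" using x by (auto simp: J_def w_def ivp_solution_def)
    fix r assume r: "r \<in> J"
    show "w r \<in> D" using r w2[of r] flow_in_domain by (auto simp: J_def mem) (auto simp: w_def)
    show "(w has_vector_derivative f (w r)) (at r)"
    proof (cases "r \<in> I x")
      case True
      then have "((\<lambda>t. \<phi> t x) has_vector_derivative f (w r)) (at r)"
        using x by (auto simp: ivp_solution_def w_def)
      then show ?thesis
        by (rule has_vector_derivative_transform_within_open[OF _ o(1) True]) (simp add: w_def)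
    next
      case False
      with r have r': "r \<in> (\<lambda>s. t + s) ` I ?y" by (auto simp: J_def)
      then have "((\<lambda>t. \<phi> t ?y) has_vector_derivative f (w r)) (at (r - t))"
        using y w2[of r] by (auto simp: ivp_solution_def)
      moreover have "((\<lambda>s. s - t) has_vector_derivative 1) (at r)"
        by (auto intro!: derivative_eq_intros)
      ultimately have "((\<lambda>r. \<phi> (r - t) ?y) has_vector_derivative f (w r)) (at r)"
        using vector_diff_chain_at[of "\<lambda>s. s - t" 1 r "\<lambda>t. \<phi> t ?y"] by (simp add: o_def)
      then show ?thesis
        by (rule has_vector_derivative_transform_within_open[OF _ o(2) r']) (simp add: w2 mem)
    qed
  qed
  moreover have "t + s \<in> J" using s by (auto simp: J_def)
  ultimately show ?thesis by (rule flow_eq)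
qed

text \<open>In a compact tube around \<open>K\<close>, the radius, the Lipschitz constant and the
  speed bound are common to all starting points, and the Picard-Lindelof time depends only on
  these.\<close>

lemma uniform_existence:
  assumes "compact K" "K \<subseteq> D"
  obtains h where "0 < h" "\<And>x. x \<in> K \<Longrightarrow> {-h<..<h} \<subseteq> I x"
proof -
  obtain r L where r: "0 < r" and c: "compact (\<Union>x\<in>K. cball x r)" and sub: "(\<Union>x\<in>K. cball x r) \<subseteq> D"
    and L: "L-lipschitz_on (\<Union>x\<in>K. cball x r) f"
    using lipschitz_tube assms by metis
  have "bounded (f ` (\<Union>x\<in>K. cball x r))"
    using compact_continuous_image[OF lipschitz_on_continuous_on[OF L] c] by (rule compact_imp_bounded)
  then obtain M where M: "0 < M" "\<And>y. y \<in> (\<Union>x\<in>K. cball x r) \<Longrightarrow> norm (f y) \<le> M"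
    unfolding bounded_pos by blast
  have L0: "0 \<le> L" using L by (rule lipschitz_on_nonneg)
  \<comment> \<open>\<open>L + 1\<close> makes \<open>h * L < 1\<close> strict and covers
    \<open>L = 0\<close>; \<open>r / M\<close> ensures \<open>h * M \<le> r\<close>.\<close>
  define h where "h = min (1 / (L + 1)) (r / M)"
  have "h * L \<le> 1 / (L + 1) * L" using L0 by (intro mult_right_mono) (auto simp: h_def)
  also have "\<dots> < 1" using L0 by (simp add: field_simps)
  finally have hL: "h * L < 1" .
  have hM: "h * M \<le> r" using M(1) by (simp add: h_def min_def field_simps)
  have h0: "0 < h" using L0 r M by (simp add: h_def)
  show thesis
  proof (rule that[OF h0])
    fix x assume x: "x \<in> K"
    then have cb: "cball x r \<subseteq> (\<Union>x\<in>K. cball x r)" by blast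
    obtain u where u: "u 0 = x"
      "\<And>t. t \<in> {-h<..<h} \<Longrightarrow> u t \<in> cball x r \<and> (u has_vector_derivative f (u t)) (at t)"
      using picard_lindelof[OF lipschitz_on_subset[OF L cb], of M h] M(2) cb r h0 hL hM by (metis less_imp_le subsetD)
    have "ivp_solution D f x {-h<..<h} u"
      using u h0 cb sub by (force simp: ivp_solution_def is_interval_1)
    then show "{-h<..<h} \<subseteq> I x" using flow_eq(1) by blast
  qed
qed

end

section \<open>Strict recurrent Lyapunov functions\<close>

text \<open>Expansion in the standard basis gives the upper bound, which makes \<open>N\<close>
  Lipschitz. Its minimum on the compact unit sphere is then attained, is positive, and gives the
  lower bound by scaling.\<close>

lemma is_norm_equivalent:
  assumes "is_norm N"
  obtains a b where "0 < a" "0 < b" "\<And>x. a * norm x \<le> N x" "\<And>x. N x \<le> b * norm (x :: real ^ 'd)"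
proof -
  have nonneg: "0 \<le> N x" and zero: "N x = 0 \<longleftrightarrow> x = 0" and scale: "N (c *\<^sub>R x) = \<bar>c\<bar> * N x"
    and tri: "N (x + y) \<le> N x + N y" for x y c
    using assms by (auto simp: is_norm_def)
  have N_sum: "N (\<Sum>i\<in>A. g i) \<le> (\<Sum>i\<in>A. N (g i))" if "finite A" for A and g :: "'d \<Rightarrow> real ^ 'd"
    using that by (induction A) (auto simp: zero[THEN iffD2] intro: order_trans[OF tri])
  define b where "b = (\<Sum>i\<in>UNIV. N (axis i 1 :: real ^ 'd)) + 1"
  have b0: "0 < b" unfolding b_def using nonneg by (simp add: add_nonneg_pos sum_nonneg)
  have upper: "N x \<le> b * norm x" for x
  proof -
    have "N x = N (\<Sum>i\<in>UNIV. (x $ i) *\<^sub>R axis i 1)"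
      by (rule arg_cong[of _ _ N]) (simp add: vec_eq_iff axis_def if_distrib cong: if_cong)
    also have "\<dots> \<le> (\<Sum>i\<in>UNIV. N ((x $ i) *\<^sub>R axis i 1))" by (rule N_sum) simp
    also have "\<dots> \<le> (\<Sum>i\<in>UNIV. norm x * N (axis i 1 :: real ^ 'd))"
      using component_le_norm_cart[of x] nonneg by (intro sum_mono) (auto simp: scale intro: mult_right_mono)
    also have "\<dots> \<le> b * norm x" by (simp add: b_def algebra_simps flip: sum_distrib_left)
    finally show ?thesis .
  qed
  have "b-lipschitz_on UNIV N"
  proof (rule lipschitz_onI)
    fix x y
    have "N x \<le> N (x - y) + N y" "N y \<le> N (y - x) + N x" using tri[of "x - y" y] tri[of "y - x" x] by auto
    moreover have "N (y - x) = N (x - y)" using scale[of "-1" "x - y"] by simp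
    ultimately show "dist (N x) (N y) \<le> b * dist x y"
      using upper[of "x - y"] by (simp add: dist_norm)
  qed (use b0 in simp)
  then have "continuous_on (sphere 0 1) N"
    using lipschitz_on_continuous_on continuous_on_subset by blast
  \<comment> \<open>An arbitrary coordinate vector shows that the sphere is nonempty.\<close>
  moreover have "(axis undefined 1 :: real ^ 'd) \<in> sphere 0 1" by simp
  ultimately obtain z where z: "z \<in> sphere 0 1" "\<And>y. y \<in> sphere 0 1 \<Longrightarrow> N z \<le> N y"
    using continuous_attains_inf[OF compact_sphere] by blast
  have "z \<noteq> 0" using z(1) by auto
  then have "0 < N z" using nonneg[of z] zero[of z] by simp
  moreover have "N z * norm x \<le> N x" for x
  proof (cases "x = 0")
    case False
    then have "N z \<le> N ((1 / norm x) *\<^sub>R x)" by (intro z) simp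
    then show ?thesis using False by (simp add: scale field_simps)
  qed (simp add: nonneg)
  ultimately show thesis using that b0 upper by blast
qed

section \<open>Returns to S and global existence\<close>

locale srlf = lipschitz_field +
  fixes xs S \<tau> V
  assumes compact_S: "compact S" and S_sub: "S \<subseteq> D" and xs_interior: "xs \<in> interior S"
    and tau: "0 < \<tau>"
    and equilibrium: "equilibrium D f xs"
    and SRLF: "SRLF D f xs S \<tau> V"
begin

lemma V_continuous: "continuous_on D V"
  and V_xs: "V xs = 0"
  and V_pos: "x \<in> D \<Longrightarrow> x \<noteq> xs \<Longrightarrow> 0 < V x"
  using SRLF by (auto simp: SRLF_def)

text \<open>A single time serves both clauses: away from \<open>xs\<close> the strict clause implies
  the weak one, and at \<open>xs\<close> only the weak one is claimed.\<close>

lemma recurrence: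
  assumes "x \<in> S"
  obtains s where "0 < s" "s \<le> \<tau>" "s \<in> I x" "\<phi> s x \<in> S" "V (\<phi> s x) \<le> V x" "x \<noteq> xs \<Longrightarrow> V (\<phi> s x) < V x"
proof (cases "x = xs")
  case True
  then show ?thesis using SRLF assms that by (auto simp: SRLF_def containment_times_def)
next
  case False
  with assms SRLF have "\<exists>s\<in>containment_times D f S x \<tau>. V (\<phi> s x) < V x" by (auto simp: SRLF_def)
  then show ?thesis using that by (auto simp: containment_times_def)
qed

text \<open>Single recurrence steps may be arbitrarily short. The latest admissible time up to \<open>\<tau>\<close> is
  attained, because solutions starting in \<open>S\<close> exist for a uniform time; one step from there
  passes \<open>\<tau>\<close>.\<close>

lemma long_return:
  assumes x: "x \<in> S"
  obtains s where "\<tau> \<le> s" "s \<le> 2 * \<tau>" "s \<in> I x" "\<phi> s x \<in> S" "V (\<phi> s x) \<le> V x"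
proof -
  obtain h where h: "0 < h" "\<And>x. x \<in> S \<Longrightarrow> {-h<..<h} \<subseteq> I x"
    using uniform_existence[OF compact_S S_sub] by blast
  define A where "A = {s \<in> {0<..\<tau>}. s \<in> I x \<and> \<phi> s x \<in> S \<and> V (\<phi> s x) \<le> V x}"
  have ne: "A \<noteq> {}" using recurrence[OF x] by (auto simp: A_def)
  have bdd: "bdd_above A" by (rule bdd_aboveI[of _ \<tau>]) (auto simp: A_def)
  define \<sigma> where "\<sigma> = Sup A"
  have le: "a \<le> \<sigma>" if "a \<in> A" for a unfolding \<sigma>_def using cSup_upper[OF that bdd] .
  have pos: "0 < \<sigma>" using ne le by (force simp: A_def)
  have sig_tau: "\<sigma> \<le> \<tau>" unfolding \<sigma>_def by (rule cSup_least[OF ne]) (auto simp: A_def)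
  \<comment> \<open>From the point \<open>\<phi> a x\<close> of \<open>S\<close> the solution lives
    for every time below \<open>h\<close>, long enough to reach \<open>\<sigma>\<close>. Without
    this, the supremum might be an endpoint of \<open>I x\<close>.\<close>
  obtain a where a: "a \<in> A" "\<sigma> - h < a"
    using less_cSup_iff[OF ne bdd, of "\<sigma> - h"] h(1) by (auto simp: \<sigma>_def)
  have "\<sigma> - a \<in> I (\<phi> a x)" using h(2)[of "\<phi> a x"] a le[OF a(1)] h(1) by (auto simp: A_def)
  then have sig_I: "\<sigma> \<in> I x" using flow_extend[of a x "\<sigma> - a"] a by (auto simp: A_def)
  have "closure A \<subseteq> {0..\<sigma>}" by (rule closure_minimal) (use le in \<open>auto simp: A_def\<close>)
  then have cont: "continuous_on (closure A) (\<lambda>t. \<phi> t x)"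
    using max_interval_between[OF sig_I] by (intro continuous_on_flow) blast
  have "closed {y \<in> S. V y \<le> V x}"
    using compact_S S_sub V_continuous
    by (intro continuous_on_closed_Collect_le) (auto intro: continuous_on_subset compact_imp_closed)
  from image_closure_subset[OF cont this] have "(\<lambda>t. \<phi> t x) ` closure A \<subseteq> {y \<in> S. V y \<le> V x}"
    by (auto simp: A_def)
  moreover have "\<sigma> \<in> closure A" unfolding \<sigma>_def by (rule closure_contains_Sup[OF ne bdd])
  ultimately have sig: "\<phi> \<sigma> x \<in> S" "V (\<phi> \<sigma> x) \<le> V x" by auto
  obtain s where s: "0 < s" "s \<le> \<tau>" "s \<in> I (\<phi> \<sigma> x)" "\<phi> s (\<phi> \<sigma> x) \<in> S" "V (\<phi> s (\<phi> \<sigma> x)) \<le> V (\<phi> \<sigma> x)"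
    using recurrence[OF sig(1)] by metis
  have ext: "\<sigma> + s \<in> I x" using flow_extend[OF sig_I s(3)] .
  then have eq: "\<phi> s (\<phi> \<sigma> x) = \<phi> (\<sigma> + s) x" using flow_shift[OF sig_I] by simp
  have "\<tau> \<le> \<sigma> + s"
  proof (rule ccontr)
    assume "\<not> \<tau> \<le> \<sigma> + s"
    then have "\<sigma> + s \<in> A" using pos s sig ext eq by (auto simp: A_def)
    then show False using le s(1) by fastforce
  qed
  then show thesis using that[of "\<sigma> + s"] ext s sig eq sig_tau by auto
qed

text \<open>Returns of length at least \<open>\<tau>\<close> cannot accumulate at a finite time:
  \<open>n\<close> of them pass \<open>n * \<tau>\<close>.\<close>

lemma late_visit:
  assumes "x \<in> S"
  shows "\<exists>t \<ge> real n * \<tau>. t \<in> I x \<and> \<phi> t x \<in> S"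
proof (induction n)
  case 0
  obtain s where "0 < s" "s \<in> I x" using recurrence[OF assms] .
  then show ?case using assms flow_zero max_interval_zero by (intro exI[of _ 0]) auto
next
  case (Suc n)
  then obtain t where t: "t \<ge> real n * \<tau>" "t \<in> I x" "\<phi> t x \<in> S" by blast
  obtain s where s: "\<tau> \<le> s" "s \<in> I (\<phi> t x)" "\<phi> s (\<phi> t x) \<in> S" using long_return[OF t(3)] .
  show ?case
    using t s flow_extend[OF t(2) s(2)] flow_shift[OF t(2), of s]
    by (intro exI[of _ "t + s"]) (auto simp: algebra_simps)
qed

lemma forward_complete:
  assumes "x \<in> S" "0 \<le> t"
  shows "t \<in> I x"
proof -
  obtain n :: nat where "t < real n * \<tau>" using reals_Archimedean3[OF tau] by blast
  moreover obtain s where "s \<ge> real n * \<tau>" "s \<in> I x" using late_visit[OF assms(1)] by blast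
  ultimately show ?thesis using max_interval_between[of s x] assms(2) by auto
qed

section \<open>Stability\<close>

lemma equilibrium_tube:
  assumes "0 < \<epsilon>"
  obtains \<rho> where "0 < \<rho>" "ball xs \<rho> \<subseteq> S"
    "\<And>y t. y \<in> ball xs \<rho> \<Longrightarrow> t \<in> {0..2 * \<tau>} \<Longrightarrow> dist (\<phi> t y) xs \<le> \<epsilon>"
proof -
  \<comment> \<open>Nearby solutions are compared with the constant one over
    \<open>2 * \<tau>\<close>, which bounds the gap between successive long returns.\<close>
  have "ivp_solution D f xs UNIV (\<lambda>_. xs)"
    using equilibrium by (simp add: ivp_solution_def equilibrium_def)
  then obtain C d where C: "0 < C" "0 < d" and
    *: "\<And>y J' v t. ivp_solution D f y J' v \<Longrightarrow> 2 * \<tau> \<in> J' \<Longrightarrow> dist xs y < d \<Longrightarrow> t \<in> {0..2 * \<tau>} \<Longrightarrow>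
       dist xs (v t) \<le> C * dist xs y"
    using continuous_dependence[of xs UNIV "\<lambda>_. xs" "2 * \<tau>"] tau by auto
  obtain \<eta> where \<eta>: "0 < \<eta>" "ball xs \<eta> \<subseteq> S" using xs_interior by (auto simp: mem_interior)
  \<comment> \<open>\<open>\<eta>\<close> puts the ball inside \<open>S\<close>, where solutions are
    global; \<open>d\<close> is the range of the estimate, and \<open>\<epsilon> / C\<close> makes
    its bound \<open>\<epsilon>\<close>.\<close>
  define \<rho> where "\<rho> = Min {\<eta>, d, \<epsilon> / C}"
  have \<rho>: "0 < \<rho>" "\<rho> \<le> \<eta>" "\<rho> \<le> d" "\<rho> \<le> \<epsilon> / C" using \<eta> C assms by (auto simp: \<rho>_def)
  show thesis
  proof (rule that[OF \<rho>(1)])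
    show sub: "ball xs \<rho> \<subseteq> S" using \<eta>(2) \<rho>(2) subset_ball[of \<rho> \<eta> xs] by blast
    fix y t assume y: "y \<in> ball xs \<rho>" and t: "t \<in> {0..2 * \<tau>}"
    have 2: "2 * \<tau> \<in> I y" using forward_complete sub y tau by auto
    have "dist xs (\<phi> t y) \<le> C * dist xs y"
      by (rule *[OF flow_ivp_solution[OF 2] 2 _ t]) (use y \<rho> in auto)
    also have "\<dots> \<le> C * (\<epsilon> / C)" using y \<rho> C by (intro mult_left_mono) auto
    finally show "dist (\<phi> t y) xs \<le> \<epsilon>" using C by (simp add: dist_commute)
  qed
qed

text \<open>On the compact set \<open>S - ball xs \<rho>\<close> the positive continuous function
  \<open>V\<close> has a positive minimum, which serves as \<open>c\<close>.\<close>

lemma sublevel_in_ball: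
  assumes "0 < \<rho>"
  obtains c where "0 < c" "\<And>y. y \<in> S \<Longrightarrow> V y < c \<Longrightarrow> y \<in> ball xs \<rho>"
proof (cases "S - ball xs \<rho> = {}")
  case True
  then show thesis by (intro that[of 1]) auto
next
  case False
  have "compact (S - ball xs \<rho>)" using compact_S by (simp add: compact_diff)
  moreover have "continuous_on (S - ball xs \<rho>) V"
    using V_continuous by (rule continuous_on_subset) (use S_sub in auto)
  ultimately obtain z where z: "z \<in> S - ball xs \<rho>" "\<And>y. y \<in> S - ball xs \<rho> \<Longrightarrow> V z \<le> V y"
    using continuous_attains_inf False by metis
  have "0 < V z" using z(1) S_sub assms by (intro V_pos) auto
  then show thesis using that[of "V z"] z by (meson DiffI not_le)
qed

lemma euclidean_stable:
  assumes "0 < \<epsilon>"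
  shows "\<exists>\<delta>>0. \<forall>x. dist x xs \<le> \<delta> \<longrightarrow> (\<forall>t\<ge>0. t \<in> I x \<and> dist (\<phi> t x) xs \<le> \<epsilon>)"
proof -
  obtain \<rho> where \<rho>: "0 < \<rho>" "ball xs \<rho> \<subseteq> S"
    "\<And>y t. y \<in> ball xs \<rho> \<Longrightarrow> t \<in> {0..2 * \<tau>} \<Longrightarrow> dist (\<phi> t y) xs \<le> \<epsilon>"
    using equilibrium_tube[OF assms] by blast
  obtain c where c: "0 < c" "\<And>y. y \<in> S \<Longrightarrow> V y < c \<Longrightarrow> y \<in> ball xs \<rho>"
    using sublevel_in_ball[OF \<rho>(1)] by blast
  have xsS: "xs \<in> S" using xs_interior interior_subset by blast
  then obtain d where d: "0 < d" "\<And>y. y \<in> S \<Longrightarrow> dist y xs < d \<Longrightarrow> dist (V y) (V xs) < c"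
    using continuous_on_subset[OF V_continuous S_sub] c(1) unfolding continuous_on_iff by metis
  \<comment> \<open>Halving leaves room for the non-strict inequality in the definition of
    stability.\<close>
  define \<delta> where "\<delta> = min d \<rho> / 2"
  have \<delta>: "0 < \<delta>" "\<delta> < d" "\<delta> < \<rho>" using d(1) \<rho>(1) by (auto simp: \<delta>_def)
  have "\<forall>t\<ge>0. t \<in> I x \<and> dist (\<phi> t x) xs \<le> \<epsilon>" if x: "dist x xs \<le> \<delta>" for x
  proof -
    have xb: "x \<in> ball xs \<rho>" and xS: "x \<in> S" using x \<delta> \<rho>(2) by (auto simp: dist_commute)
    have Vx: "V x < c" using d(2)[OF xS] x \<delta> by (auto simp: V_xs dist_real_def)
    have I0: "0 \<in> I x" using forward_complete[OF xS] by simp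
    \<comment> \<open>The visited points stay in the sublevel set below \<open>c\<close>, hence in
      the ball of radius \<open>\<rho>\<close>; between visits the path may leave \<open>S\<close>
      but remains within \<open>\<epsilon>\<close> of \<open>xs\<close>.\<close>
    have run: "\<exists>t \<ge> real n * \<tau>. \<phi> t x \<in> S \<and> V (\<phi> t x) < c \<and> (\<forall>s\<in>{0..t}. dist (\<phi> s x) xs \<le> \<epsilon>)" for n
    proof (induction n)
      case 0
      show ?case using xS Vx flow_zero[OF I0] \<rho>(3)[OF xb, of 0] tau by (intro exI[of _ 0]) auto
    next
      case (Suc n)
      then obtain t where t: "t \<ge> real n * \<tau>" "\<phi> t x \<in> S" "V (\<phi> t x) < c"
        "\<And>s. s \<in> {0..t} \<Longrightarrow> dist (\<phi> s x) xs \<le> \<epsilon>" by blast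
      have t0: "0 \<le> t" using t(1) tau by (meson dual_order.trans less_imp_le mult_nonneg_nonneg of_nat_0_le_iff)
      then have shift: "\<phi> s (\<phi> t x) = \<phi> (t + s) x" if "0 \<le> s" for s
        using flow_shift(2)[OF forward_complete[OF xS] forward_complete[OF xS]] that by auto
      obtain r where r: "\<tau> \<le> r" "r \<le> 2 * \<tau>" "\<phi> r (\<phi> t x) \<in> S" "V (\<phi> r (\<phi> t x)) \<le> V (\<phi> t x)"
        using long_return[OF t(2)] by blast
      have "dist (\<phi> s x) xs \<le> \<epsilon>" if s: "s \<in> {0..t + r}" for s
      proof (cases "s \<le> t")
        case False
        then show ?thesis using \<rho>(3)[OF c(2)[OF t(2,3)], of "s - t"] shift[of "s - t"] s r by auto
      qed (use s t in auto)
      then show ?case using t r shift[of r] tau by (intro exI[of _ "t + r"]) (auto simp: algebra_simps)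
    qed
    show ?thesis
    proof (intro allI impI conjI)
      fix t :: real assume t: "0 \<le> t"
      show "t \<in> I x" using forward_complete xS t .
      obtain n :: nat where "t < real n * \<tau>" using reals_Archimedean3[OF tau] by blast
      then show "dist (\<phi> t x) xs \<le> \<epsilon>" using run[of n] t by fastforce
    qed
  qed
  then show ?thesis using \<delta>(1) by blast
qed

section \<open>Attractivity\<close>

text \<open>Minimising over the limit set, instead of bounding the decrease of \<open>V\<close> along returns, is
  needed because \<open>\<phi> s y \<in> S\<close> need not persist under perturbations of \<open>y\<close>.\<close>

lemma equilibrium_in_limit_set:
  assumes x: "x \<in> S" and "0 \<le> T"
  shows "xs \<in> closure ((\<lambda>t. \<phi> t x) ` {T..})"
proof -
  \<comment> \<open>The intersection of the closures of all tails is the limit set of the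
    orbit.\<close>
  define \<Omega> where "\<Omega> = S \<inter> (\<Inter>T\<in>{0..}. closure ((\<lambda>t. \<phi> t x) ` {T..}))"
  have "compact \<Omega>" unfolding \<Omega>_def by (intro compact_Int_closed compact_S closed_INT) simp
  have "\<Omega> \<noteq> {}"
  proof -
    obtain t where t: "\<And>n. t n \<ge> real n * \<tau>" "\<And>n. \<phi> (t n) x \<in> S"
      using late_visit[OF x] by metis
    obtain l r where l: "l \<in> S" "strict_mono r" "((\<lambda>n. \<phi> (t n) x) \<circ> r) \<longlonglongrightarrow> l"
      using compact_S t(2) unfolding compact_def by metis
    \<comment> \<open>A subsequence index satisfies \<open>n \<le> r n\<close>, so the visit times
      along it eventually exceed any \<open>T\<close>.\<close>
    have "l \<in> closure ((\<lambda>t. \<phi> t x) ` {T..})" for T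
    proof (rule Lim_in_closed_set[OF closed_closure _ _ l(3)])
      obtain m :: nat where m: "T < real m * \<tau>" using reals_Archimedean3[OF tau] by blast
      have "T \<le> t (r n)" if "m \<le> n" for n
      proof -
        have "m \<le> r n" using that seq_suble[OF l(2), of n] by linarith
        then have "real m * \<tau> \<le> real (r n) * \<tau>" using tau by simp
        then show ?thesis using m t(1)[of "r n"] by linarith
      qed
      then show "\<forall>\<^sub>F n in sequentially. ((\<lambda>n. \<phi> (t n) x) \<circ> r) n \<in> closure ((\<lambda>t. \<phi> t x) ` {T..})"
        by (intro eventually_sequentiallyI[of m] subsetD[OF closure_subset]) auto
    qed simp
    then show ?thesis using l(1) by (auto simp: \<Omega>_def)
  qed
  moreover have "continuous_on \<Omega> V"
    using V_continuous by (rule continuous_on_subset) (use S_sub in \<open>auto simp: \<Omega>_def\<close>)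
  ultimately obtain z where z: "z \<in> \<Omega>" "\<And>y. y \<in> \<Omega> \<Longrightarrow> V z \<le> V y"
    using continuous_attains_inf[OF \<open>compact \<Omega>\<close>] by metis
  have "z = xs"
  proof (rule ccontr)
    assume "z \<noteq> xs"
    moreover have "z \<in> S" using z(1) by (simp add: \<Omega>_def)
    ultimately obtain s where s: "0 < s" "s \<in> I z" "\<phi> s z \<in> S" "V (\<phi> s z) < V z"
      using recurrence by metis
    obtain C d where C: "0 < C" "0 < d" and
      *: "\<And>y J' v t. ivp_solution D f y J' v \<Longrightarrow> s \<in> J' \<Longrightarrow> dist z y < d \<Longrightarrow> t \<in> {0..s} \<Longrightarrow>
         dist (\<phi> t z) (v t) \<le> C * dist z y"
      using continuous_dependence[OF flow_ivp_solution[OF s(2)] s(2)] s(1) by (metis less_imp_le)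
    \<comment> \<open>Forward invariance of the limit set: when the orbit passes close to
      \<open>z\<close>, continuous dependence brings it close to \<open>\<phi> s z\<close> a time
      \<open>s\<close> later. As \<open>\<phi> s z\<close> lies in \<open>S\<close>, it competes
      with the minimiser \<open>z\<close>.\<close>
    have "\<phi> s z \<in> closure ((\<lambda>t. \<phi> t x) ` {T..})" if T: "0 \<le> T" for T
      unfolding closure_approachable
    proof (intro allI impI)
      fix e :: real assume e: "0 < e"
      have "z \<in> closure ((\<lambda>t. \<phi> t x) ` {T..})" using z(1) T by (auto simp: \<Omega>_def)
      moreover have "0 < min d (e / C)" using C e by simp
      ultimately obtain t where t: "T \<le> t" "dist (\<phi> t x) z < min d (e / C)"
        unfolding closure_approachable by blast
      have tI: "t \<in> I x" "t + s \<in> I x" using forward_complete[OF x] T t(1) s(1) by auto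
      note sh = flow_shift[OF tI]
      have "dist (\<phi> s z) (\<phi> s (\<phi> t x)) \<le> C * dist z (\<phi> t x)"
        by (rule *[OF flow_ivp_solution[OF sh(1)] sh(1)]) (use t s(1) in \<open>auto simp: dist_commute\<close>)
      also have "\<dots> < e" using t(2) C by (simp add: dist_commute field_simps)
      finally show "\<exists>y\<in>(\<lambda>t. \<phi> t x) ` {T..}. dist y (\<phi> s z) < e"
        using t(1) s(1) sh(2) by (intro bexI[of _ "\<phi> (t + s) x"]) (auto simp: dist_commute)
    qed
    then have "\<phi> s z \<in> \<Omega>" using s(3) by (auto simp: \<Omega>_def)
    then show False using z(2) s(4) by fastforce
  qed
  then show ?thesis using z(1) assms(2) by (auto simp: \<Omega>_def)
qed

text \<open>The orbit enters every neighbourhood of \<open>xs\<close>; stability, applied from the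
  entry time on, keeps it close forever.\<close>

lemma euclidean_attractive:
  assumes x: "x \<in> S"
  shows "((\<lambda>t. \<phi> t x) \<longlongrightarrow> xs) at_top"
proof (rule tendstoI)
  fix e :: real assume e: "0 < e"
  then obtain \<delta> where \<delta>: "0 < \<delta>"
    "\<And>y t. dist y xs \<le> \<delta> \<Longrightarrow> 0 \<le> t \<Longrightarrow> dist (\<phi> t y) xs \<le> e / 2"
    using euclidean_stable[of "e / 2"] by auto
  obtain T where T: "0 \<le> T" "dist (\<phi> T x) xs < \<delta>"
    using equilibrium_in_limit_set[OF x order_refl] \<delta>(1) unfolding closure_approachable by auto
  have "dist (\<phi> t x) xs < e" if t: "T \<le> t" for t
  proof -
    have "\<phi> (t - T) (\<phi> T x) = \<phi> t x"
      using flow_shift(2)[of T x "t - T"] forward_complete[OF x] T(1) t by simp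
    then show ?thesis using \<delta>(2)[of "\<phi> T x" "t - T"] T t e by simp
  qed
  then show "\<forall>\<^sub>F t in at_top. dist (\<phi> t x) xs < e"
    unfolding eventually_at_top_linorder by blast
qed

end

section \<open>Transfer to an arbitrary norm\<close>

theorem theorem2:
  fixes N :: "real ^ 'd \<Rightarrow> real"
    and D S :: "(real ^ 'd) set"
    and f :: "real ^ 'd \<Rightarrow> real ^ 'd"
    and xs :: "real ^ 'd"
    and V :: "real ^ 'd \<Rightarrow> real"
    and \<tau> :: real
  assumes "is_norm N"
    and "open D"
    and "locally_lipschitz_on N D f"
    and "equilibrium D f xs"
    and "compact S" and "S \<subseteq> D" and "xs \<in> interior S"
    and "\<tau> > 0"
    and "SRLF D f xs S \<tau> V"
  shows "asymptotically_stable_on N D f xs S"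
proof -
  obtain a b where ab: "0 < a" "0 < b" and lower: "\<And>x. a * norm x \<le> N x"
    and upper: "\<And>x. N x \<le> b * norm x"
    using is_norm_equivalent[OF assms(1)] by metis
  have N0: "0 \<le> N x" for x using assms(1) by (simp add: is_norm_def)
  have lip: "\<exists>L. L-lipschitz_on K f" if K: "compact K" "K \<subseteq> D" for K
  proof -
    obtain L where L: "0 \<le> L" "\<forall>x\<in>K. \<forall>y\<in>K. N (f y - f x) \<le> L * N (y - x)"
      using assms(3)[unfolded locally_lipschitz_on_def, rule_format, of K] K by auto
    \<comment> \<open>The lower norm bound applies to the values of \<open>f\<close>, the upper one
      to the arguments.\<close>
    have "(L * b / a)-lipschitz_on K f"
    proof (rule lipschitz_onI)
      fix x y assume xy: "x \<in> K" "y \<in> K"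
      have "a * norm (f x - f y) \<le> N (f x - f y)" by (rule lower)
      also have "\<dots> \<le> L * N (x - y)" using L(2) xy by blast
      also have "\<dots> \<le> L * (b * norm (x - y))" using L(1) upper by (rule mult_left_mono[rotated])
      finally show "dist (f x) (f y) \<le> L * b / a * dist x y"
        using ab by (simp add: dist_norm field_simps)
    qed (use L(1) ab in simp)
    then show ?thesis by blast
  qed
  interpret srlf D f xs S \<tau> V
    by unfold_locales (use assms lip in auto)
  have "stable N D f xs"
    unfolding stable_def
  proof (intro allI impI)
    fix \<epsilon> :: real assume "0 < \<epsilon>"
    \<comment> \<open>Euclidean closeness \<open>\<epsilon> / b\<close> gives
      \<open>N\<close>-closeness \<open>\<epsilon>\<close>, and \<open>N\<close>-closeness
      \<open>a * \<delta>\<close> gives Euclidean closeness \<open>\<delta>\<close>.\<close>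
    then have "0 < \<epsilon> / b" using ab by simp
    then obtain \<delta> where \<delta>: "0 < \<delta>"
      "\<And>x t. dist x xs \<le> \<delta> \<Longrightarrow> 0 \<le> t \<Longrightarrow> t \<in> I x \<and> dist (\<phi> t x) xs \<le> \<epsilon> / b"
      using euclidean_stable by metis
    have "t \<in> I x \<and> N (\<phi> t x - xs) \<le> \<epsilon>" if x: "N (x - xs) \<le> a * \<delta>" and t: "0 \<le> t" for x t
    proof -
      have "a * norm (x - xs) \<le> a * \<delta>" using lower x by (rule order_trans)
      then have "dist x xs \<le> \<delta>" using ab by (simp add: dist_norm)
      from \<delta>(2)[OF this t] have "t \<in> I x" "b * norm (\<phi> t x - xs) \<le> \<epsilon>"
        using ab by (auto simp: dist_norm field_simps)
      then show ?thesis using upper[of "\<phi> t x - xs"] by linarith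
    qed
    then show "\<exists>\<delta>>0. \<forall>x. N (x - xs) \<le> \<delta> \<longrightarrow> (\<forall>t\<ge>0. t \<in> I x \<and> N (\<phi> t x - xs) \<le> \<epsilon>)"
      using \<delta>(1) ab by (intro exI[of _ "a * \<delta>"]) auto
  qed
  moreover have "attractive_on N D f xs S"
    unfolding attractive_on_def
  proof (intro ballI conjI)
    fix x assume x: "x \<in> S"
    show "{0..} \<subseteq> I x" using forward_complete[OF x] by auto
    have "((\<lambda>t. b * norm (\<phi> t x - xs)) \<longlongrightarrow> b * norm (xs - xs)) at_top"
      by (intro tendsto_intros euclidean_attractive x)
    then have lim: "((\<lambda>t. b * norm (\<phi> t x - xs)) \<longlongrightarrow> 0) at_top" by simp
    show "((\<lambda>t. N (\<phi> t x - xs)) \<longlongrightarrow> 0) at_top"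
      by (rule tendsto_sandwich[OF _ _ tendsto_const lim]) (simp_all add: N0 upper)
  qed
  ultimately show ?thesis by (simp add: asymptotically_stable_on_def)
qed

end
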